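(* Let $m\ge2$, $N\ge1$, $M\in\mathfrak{M}_m$, $\delta=\delta(DM)$, and $0<\varepsilon<\delta/10$. Then there exists $M'\in\mathfrak{ds}_m$ such that $d_B(M,M')<\varepsilon$ and $CS(M')$ is a tree. If, moreover, $M\in\mathfrak{ds}_m$, then $CS(M')$ is a tree for every $M'\in B_{\mathfrak{M}_m}(M,\varepsilon)=\{M'\in\mathfrak{M}_m:d_B(M,M')<\varepsilon\}$.
   Context: $d$ is the Euclidean distance on $\mathbb{R}^N$; $\mathfrak{M}_m$ is the set of $m$-element subsets of $\mathbb{R}^N$, each regarded as a metric space with $d$. For $M,M'\in\mathfrak{M}_m$, $d_B(M,M')=\min_f\max_{x\in M}d(x,f(x))$, the minimum over bijections $f:M\to M'$. $DM=\{d(x,y):x,y\in M\}$ (containing $0$), and $\delta(DM)=\min\{|r-r'|:r,r'\in DM, r\ne r'\}$. $M$ is distance separated if all distances between distinct unordered pairs of its points are pairwise different; $\mathfrak{ds}_m$ is the set of distance separated $M\in\mathfrak{M}_m$. Connected sparse graph $CS(M)$ (vertex set $M$): $S_0$ has no edges, $K_0=\{\{x\}\}$; $\nu_0(\{x\})=\min_{y\ne x}d(x,y)$; $E(S_1)=\{\{x,y\}:y\neq x,\ d(x,y)=\nu_0(\{x\})\}$. If the set $K_i$ of components of $S_i$ has $|K_i|>1$, set $\nu_i(k)=\min\{d(x,y):x\in k,y\notin k\}$, $F(S_{i+1})=\{\{x,y\}:x\in k\in K_i,\ y\notin k,\ d(x,y)=\nu_i(k)\}$, $E(S_{i+1})=E(S_i)\cup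 F(S_{i+1})$; stop at the first connected $S_i$, which is $CS(M)$. *)

theory Defs
  imports "HOL-Analysis.Analysis"
begin

section \<open>Finite simple graphs\<close>

text \<open>A graph is a pair of a vertex set and a set of edges, an edge being an unordered pair
  \<open>{x, y}\<close> of distinct vertices.\<close>

type_synonym 'v graph = "'v set \<times> 'v set set"

abbreviation verts :: "'v graph \<Rightarrow> 'v set" where "verts G \<equiv> fst G"
abbreviation edges :: "'v graph \<Rightarrow> 'v set set" where "edges G \<equiv> snd G"

definition adjacency :: "'v graph \<Rightarrow> 'v rel" where
  "adjacency G = {(x, y). {x, y} \<in> edges G}"

text \<open>Components are represented by their vertex sets.\<close>

definition graph_components :: "'v graph \<Rightarrow> 'v set set" where
  "graph_components G = {{y \<in> verts G. (x, y) \<in> (adjacency G)\<^sup>*} | x. x \<in> verts G}"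

definition graph_connected :: "'v graph \<Rightarrow> bool" where
  "graph_connected G \<longleftrightarrow> card (graph_components G) = 1"

definition graph_cycle :: "'v graph \<Rightarrow> 'v list \<Rightarrow> bool" where
  "graph_cycle G xs \<longleftrightarrow> length xs \<ge> 3 \<and> distinct xs \<and> set xs \<subseteq> verts G \<and>
     (\<forall>i < length xs. {xs ! i, xs ! (Suc i mod length xs)} \<in> edges G)"

definition graph_tree :: "'v graph \<Rightarrow> bool" where
  "graph_tree G \<longleftrightarrow> graph_connected G \<and> (\<nexists>xs. graph_cycle G xs)"


section \<open>Finite metric spaces in Euclidean space\<close>

definition Msets :: "nat \<Rightarrow> (real ^ 'n) set set" where
  "Msets m = {M. finite M \<and> card M = m}"

text \<open>There are infinitely many total functions that restrict to a bijection \<open>M \<rightarrow> M'\<close>, but the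
  values minimised over lie in the finite set of distances between points of \<open>M\<close> and \<open>M'\<close>.\<close>

definition d_B :: "'a::metric_space set \<Rightarrow> 'a set \<Rightarrow> real" where
  "d_B M M' = Min {Max ((\<lambda>x. dist x (f x)) ` M) | f. bij_betw f M M'}"

definition M_ball :: "nat \<Rightarrow> (real ^ 'n) set \<Rightarrow> real \<Rightarrow> (real ^ 'n) set set" where
  "M_ball m M \<epsilon> = {M' \<in> Msets m. d_B M M' < \<epsilon>}"

definition distance_set :: "'a::metric_space set \<Rightarrow> real set" where
  "distance_set M = {dist x y | x y. x \<in> M \<and> y \<in> M}"

definition min_gap :: "real set \<Rightarrow> real" where
  "min_gap D = Min {\<bar>r - r'\<bar> | r r'. r \<in> D \<and> r' \<in> D \<and> r \<noteq> r'}"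

definition distance_separated :: "'a::metric_space set \<Rightarrow> bool" where
  "distance_separated M \<longleftrightarrow>
     (\<forall>x\<in>M. \<forall>y\<in>M. \<forall>u\<in>M. \<forall>v\<in>M.
        x \<noteq> y \<and> u \<noteq> v \<and> {x, y} \<noteq> {u, v} \<longrightarrow> dist x y \<noteq> dist u v)"

definition ds :: "nat \<Rightarrow> (real ^ 'n) set set" where
  "ds m = {M \<in> Msets m. distance_separated M}"


section \<open>The connected sparse graph\<close>

definition nu :: "'a::metric_space set \<Rightarrow> 'a set \<Rightarrow> real" where
  "nu M k = Min {dist x y | x y. x \<in> k \<and> y \<in> M - k}"

definition sparse_new_edges :: "'a::metric_space graph \<Rightarrow> 'a set set" where
  "sparse_new_edges G =
     {{x, y} | x y k. k \<in> graph_components G \<and> x \<in> k \<and> y \<in> verts G - k \<and>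
                      dist x y = nu (verts G) k}"

text \<open>The components of the edgeless graph are the singletons, so the step from \<open>0\<close> to \<open>1\<close>
  joins every point to its nearest neighbours. Once the graph is connected no new edges arise.\<close>

fun sparse_graph :: "'a::metric_space set \<Rightarrow> nat \<Rightarrow> 'a graph" where
  "sparse_graph M 0 = (M, {})"
| "sparse_graph M (Suc i) =
     (M, edges (sparse_graph M i) \<union> sparse_new_edges (sparse_graph M i))"

text \<open>For finite nonempty \<open>M\<close> some \<open>sparse_graph M i\<close> is connected, because each step from a
  disconnected graph joins every component to another one.\<close>

definition CS :: "'a::metric_space set \<Rightarrow> 'a graph" where
  "CS M = sparse_graph M (LEAST i. graph_connected (sparse_graph M i))"

end

theory Submission
  imports Defs
begin

text \<open>Every edge of a sparse graph is a shortest edge across some cut of \<open>M\<close>. If all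
  distances are different, then the longest edge of a cycle is not shortest across any cut,
  because the cycle crosses the cut a second time; so no cycle exists. The set \<open>M\<close> is made
  distance separated by moving its \<open>i\<close>-th point by \<open>s * 2^i\<close> in a fixed direction: the squared
  distances become quadratic polynomials in \<open>s\<close> with pairwise different leading coefficients
  \<open>(2^i - 2^j)^2\<close>, so only finitely many \<open>s\<close> are bad. An \<open>\<epsilon>\<close>-perturbation changes each distance
  by less than \<open>2 * \<epsilon>\<close>, which cannot close a gap of \<open>10 * \<epsilon>\<close> between two distances.\<close>

section \<open>Edges of sparse graphs as shortest edges across cuts\<close>

lemma verts_sparse_graph [simp]: "verts (sparse_graph M i) = M"
  by (induction i) auto

text \<open>An edge enters at some step as a shortest edge leaving a component of the preceding
  stage, and that component is the cut. Only \<open>k \<subseteq> M\<close> is kept of it, so that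
  edges from all stages can be treated alike.\<close>

lemma sparse_graph_edge_cut:
  assumes "e \<in> edges (sparse_graph M i)"
  obtains x y k where "e = {x, y}" "x \<in> k" "y \<in> M - k" "k \<subseteq> M" "dist x y = nu M k"
  using assms
proof (induction i arbitrary: thesis)
  case 0
  then show ?case by simp
next
  case (Suc i)
  show ?case
  proof (cases "e \<in> edges (sparse_graph M i)")
    case True
    then show ?thesis using Suc by blast
  next
    case False
    then have "e \<in> sparse_new_edges (sparse_graph M i)"
      using Suc.prems by simp
    then obtain x y k where *: "e = {x, y}" "k \<in> graph_components (sparse_graph M i)"
      "x \<in> k" "y \<in> M - k" "dist x y = nu M k"
      unfolding sparse_new_edges_def by auto
    moreover have "k \<subseteq> M"
      using *(2) by (auto simp: graph_components_def)
    ultimately show ?thesis using Suc.prems(1) by blast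
  qed
qed

lemma finite_cut_distances:
  assumes "finite M" "k \<subseteq> M"
  shows "finite {dist x y | x y. x \<in> k \<and> y \<in> M - k}"
proof (rule finite_subset)
  show "{dist x y | x y. x \<in> k \<and> y \<in> M - k} \<subseteq> (\<lambda>(x, y). dist x y) ` (M \<times> M)"
    using assms(2) by auto
qed (use assms(1) in simp)

lemma nu_le:
  assumes "finite M" "k \<subseteq> M" "x \<in> k" "y \<in> M - k"
  shows "nu M k \<le> dist x y"
  unfolding nu_def using assms by (intro Min_le finite_cut_distances) auto

lemma nu_attained:
  assumes "finite M" "k \<subseteq> M" "k \<noteq> {}" "k \<noteq> M"
  obtains x y where "x \<in> k" "y \<in> M - k" "dist x y = nu M k"
proof -
  have "nu M k \<in> {dist x y | x y. x \<in> k \<and> y \<in> M - k}"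
    unfolding nu_def using assms by (intro Min_in finite_cut_distances) auto
  then show ?thesis using that by auto
qed

section \<open>Absence of cycles under distance separation\<close>

text \<open>After leaving \<open>A\<close> the closed walk must re-enter it, since it is back at
  \<open>c i\<close> after \<open>n\<close> steps. The re-entering edge could equal the leaving one
  only if traversed backwards, and this would make \<open>n\<close> divide 2.\<close>

lemma cycle_crosses_cut_twice:
  fixes c :: "nat \<Rightarrow> 'a"
  assumes n: "n \<ge> 3"
    and c: "\<And>s t. c s = c t \<longleftrightarrow> s mod n = t mod n"
    and out: "c i \<in> A" "c (Suc i) \<notin> A"
  obtains t where "c t \<notin> A" "c (Suc t) \<in> A" "{c t, c (Suc t)} \<noteq> {c i, c (Suc i)}"
proof -
  have "\<exists>t\<ge>Suc i. c t \<notin> A \<and> c (Suc t) \<in> A"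
  proof (rule ccontr)
    assume *: "\<not> ?thesis"
    have "c (Suc i + d) \<notin> A" for d
    proof (induction d)
      case (Suc d)
      then show ?case using *[simplified, rule_format, of "Suc i + d"] by auto
    qed (use out in simp)
    \<comment> \<open>The shift \<open>n - 1\<close> is counted from \<open>Suc i\<close>, hence it
      lands one full period after \<open>i\<close>.\<close>
    from this[of "n - 1"] have "c (i + n) \<notin> A" using n by simp
    moreover have "c (i + n) = c i" by (subst c) simp
    ultimately show False using out by simp
  qed
  then obtain t where t: "c t \<notin> A" "c (Suc t) \<in> A" by blast
  have "{c t, c (Suc t)} \<noteq> {c i, c (Suc i)}"
  proof
    assume "{c t, c (Suc t)} = {c i, c (Suc i)}"
    then have "c t = c (Suc i)" "c (Suc t) = c i"
      using t out by (auto simp: doubleton_eq_iff)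
    then have "t mod n = Suc i mod n" "Suc t mod n = i mod n"
      by (simp_all add: c)
    then have "(i + 2) mod n = i mod n"
      by (metis add_2_eq_Suc' mod_Suc_eq)
    then have "n dvd 2"
      by (simp add: mod_eq_dvd_iff_nat)
    then show False using n dvd_imp_le[of n 2] by simp
  qed
  with t show ?thesis using that by blast
qed

text \<open>Periodic extension of the vertex list to all natural numbers moves the wrap-around at
  the end of the list into congruences modulo \<open>n\<close>.\<close>

lemma graph_cycle_parametrization:
  assumes "graph_cycle G xs"
  obtains n c where "n \<ge> 3" "\<And>s t. c s = c t \<longleftrightarrow> s mod n = t mod n"
    "\<And>t. c t \<in> verts G" "\<And>t. {c t, c (Suc t)} \<in> edges G"
proof -
  define n where "n = length xs"
  define c where "c t = xs ! (t mod n)" for t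
  have n: "n \<ge> 3" and xs: "distinct xs" "set xs \<subseteq> verts G"
    and e: "\<And>i. i < n \<Longrightarrow> {xs ! i, xs ! (Suc i mod n)} \<in> edges G"
    using assms by (auto simp: graph_cycle_def n_def)
  have lt: "t mod n < n" for t using n by simp
  show ?thesis
  proof (rule that[OF n])
    show "c s = c t \<longleftrightarrow> s mod n = t mod n" for s t
      using xs(1) lt by (simp add: c_def n_def nth_eq_iff_index_eq)
    show "c t \<in> verts G" for t
      using xs(2) lt by (auto simp: c_def n_def)
    show "{c t, c (Suc t)} \<in> edges G" for t
      using e[OF lt, of t] by (simp add: c_def mod_Suc_eq)
  qed
qed

lemma sparse_graph_acyclic:
  assumes fin: "finite M" and sep: "distance_separated M"
  shows "\<not> graph_cycle (sparse_graph M j) xs"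
proof
  assume "graph_cycle (sparse_graph M j) xs"
  then obtain n c where n: "n \<ge> 3" and c: "\<And>s t. c s = c t \<longleftrightarrow> s mod n = t mod n"
    and V: "\<And>t. c t \<in> M" and E: "\<And>t. {c t, c (Suc t)} \<in> edges (sparse_graph M j)"
    by (rule graph_cycle_parametrization) auto
  \<comment> \<open>Distance separation compares only pairs of distinct points, so the edges of the
    cycle must be shown not to degenerate.\<close>
  have neq: "c t \<noteq> c (Suc t)" for t
    using n by (auto simp: c mod_Suc)
  define len where "len t = dist (c t) (c (Suc t))" for t
  \<comment> \<open>Although \<open>len\<close> lives on all natural numbers, its values are
    distances within the finite set \<open>M\<close>, so a longest edge exists.\<close>
  have "range len \<subseteq> (\<lambda>(x, y). dist x y) ` (M \<times> M)"
    using V by (auto simp: len_def)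
  then have fin_len: "finite (range len)"
    by (rule finite_subset) (use fin in simp)
  then have "Max (range len) \<in> range len"
    by (intro Max_in) auto
  then obtain i where "Max (range len) = len i"
    by auto
  then have i: "len t \<le> len i" for t
    using Max_ge[OF fin_len, of "len t"] by simp
  obtain x y k where xy: "{c i, c (Suc i)} = {x, y}" "x \<in> k" "y \<in> M - k"
    and k: "k \<subseteq> M" and d: "dist x y = nu M k"
    by (rule sparse_graph_edge_cut[OF E[of i]])
  have len_i: "len i = nu M k"
    using xy(1) d by (auto simp: len_def doubleton_eq_iff dist_commute)
  \<comment> \<open>The unordered edge does not reveal in which direction the cycle crosses the cut.
    Passing to the complement turns an entry into \<open>k\<close> into an exit from
    \<open>- k\<close>.\<close>
  consider (1) "c i \<in> k" "c (Suc i) \<notin> k" | (2) "c i \<in> - k" "c (Suc i) \<notin> - k"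
    using xy by (auto simp: doubleton_eq_iff)
  then obtain t where t: "{c t, c (Suc t)} \<noteq> {c i, c (Suc i)}"
    "c t \<notin> k \<and> c (Suc t) \<in> k \<or> c t \<in> k \<and> c (Suc t) \<notin> k"
  proof cases
    case 1
    show ?thesis
      by (rule cycle_crosses_cut_twice[OF n c 1]) (use that in blast)
  next
    case 2
    show ?thesis
      by (rule cycle_crosses_cut_twice[OF n c 2]) (use that in blast)
  qed
  then have "nu M k \<le> len t"
    using nu_le[OF fin k] V by (metis DiffI dist_commute len_def)
  \<comment> \<open>The second crossing is no shorter than the cut minimum \<open>nu M k\<close>,
    which is \<open>len i\<close>, and no longer than the longest edge.\<close>
  then have "len t = len i"
    using i[of t] len_i by simp
  then show False
    using sep t(1) V neq unfolding distance_separated_def len_def by metis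
qed

section \<open>Connectedness after finitely many steps\<close>

lemma component_closed:
  assumes "k \<in> graph_components G" "x \<in> k" "{x, y} \<in> edges G" "y \<in> verts G"
  shows "y \<in> k"
  using assms unfolding graph_components_def adjacency_def
  by (auto intro: rtrancl_into_rtrancl)

lemma disconnected_component:
  assumes "\<not> graph_connected G" "verts G \<noteq> {}"
  obtains k where "k \<in> graph_components G" "k \<noteq> {}" "k \<subseteq> verts G" "k \<noteq> verts G"
proof -
  have props: "k \<noteq> {} \<and> k \<subseteq> verts G" if "k \<in> graph_components G" for k
    using that by (auto simp: graph_components_def)
  have "graph_components G \<noteq> {}"
    using assms(2) by (auto simp: graph_components_def)
  moreover have "graph_components G \<noteq> {verts G}"
    using assms(1) by (auto simp: graph_connected_def)
  ultimately show ?thesis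
    using props that by blast
qed

lemma edges_sparse_graph_subset: "edges (sparse_graph M i) \<subseteq> Pow M"
proof
  fix e
  assume "e \<in> edges (sparse_graph M i)"
  then show "e \<in> Pow M" by (rule sparse_graph_edge_cut) auto
qed

text \<open>A shortest edge leaving a proper component is added at the next step. It cannot be
  present already, because an existing edge keeps its other endpoint in the component.\<close>

lemma edges_sparse_graph_strict_mono:
  assumes "finite M" "M \<noteq> {}" "\<not> graph_connected (sparse_graph M i)"
  shows "edges (sparse_graph M i) \<subset> edges (sparse_graph M (Suc i))"
proof -
  obtain k where k: "k \<in> graph_components (sparse_graph M i)" "k \<noteq> {}" "k \<subseteq> M" "k \<noteq> M"
    using disconnected_component[OF assms(3)] assms(2) by auto
  obtain x y where xy: "x \<in> k" "y \<in> M - k" "dist x y = nu M k"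
    using nu_attained[OF assms(1) k(3,2,4)] .
  have "{x, y} \<in> sparse_new_edges (sparse_graph M i)"
    unfolding sparse_new_edges_def using k(1) xy by auto
  moreover have "{x, y} \<notin> edges (sparse_graph M i)"
    using component_closed[OF k(1) xy(1)] xy(2) by auto
  ultimately show ?thesis by auto
qed

lemma sparse_graph_eventually_connected:
  assumes fin: "finite M" and ne: "M \<noteq> {}"
  shows "\<exists>i. graph_connected (sparse_graph M i)"
proof (rule ccontr)
  assume *: "\<not> ?thesis"
  have finE: "finite (edges (sparse_graph M i))" for i
    using edges_sparse_graph_subset fin by (metis finite_Pow_iff finite_subset)
  have "i \<le> card (edges (sparse_graph M i))" for i
  proof (induction i)
    case (Suc i)
    have "card (edges (sparse_graph M i)) < card (edges (sparse_graph M (Suc i)))"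
      using edges_sparse_graph_strict_mono[OF fin ne] * by (intro psubset_card_mono finE) blast
    with Suc show ?case by linarith
  qed simp
  \<comment> \<open>All edges are subsets of \<open>M\<close>, so their number cannot exceed
    \<open>card (Pow M)\<close>.\<close>
  from this[of "Suc (card (Pow M))"] show False
    using card_mono[OF _ edges_sparse_graph_subset, of M "Suc (card (Pow M))"] fin by simp
qed

lemma CS_tree:
  assumes "finite M" "M \<noteq> {}" "distance_separated M"
  shows "graph_tree (CS M)"
  unfolding graph_tree_def CS_def
  using LeastI_ex[OF sparse_graph_eventually_connected[OF assms(1,2)]]
    sparse_graph_acyclic[OF assms(1,3)] by blast

section \<open>The bijection distance and stability of distance separation\<close>

text \<open>The minimum over the infinitely many functions \<open>f\<close> is attained, because
  each maximum is one of the finitely many distances between \<open>M\<close> and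
  \<open>M'\<close>.\<close>

lemma d_B_less_iff:
  assumes "finite M" "M \<noteq> {}" "finite M'" "card M = card M'"
  shows "d_B M M' < r \<longleftrightarrow> (\<exists>f. bij_betw f M M' \<and> (\<forall>x\<in>M. dist x (f x) < r))"
proof -
  let ?S = "{Max ((\<lambda>x. dist x (f x)) ` M) | f. bij_betw f M M'}"
  have "?S \<subseteq> (\<lambda>(x, y). dist x y) ` (M \<times> M')"
  proof clarify
    fix f
    assume f: "bij_betw f M M'"
    have "Max ((\<lambda>x. dist x (f x)) ` M) \<in> (\<lambda>x. dist x (f x)) ` M"
      using assms by (intro Max_in) auto
    then show "Max ((\<lambda>x. dist x (f x)) ` M) \<in> (\<lambda>(x, y). dist x y) ` (M \<times> M')"
      using bij_betwE[OF f] by force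
  qed
  then have "finite ?S"
    by (rule finite_subset) (use assms in simp)
  moreover have "?S \<noteq> {}"
    using finite_same_card_bij[OF assms(1,3,4)] by auto
  ultimately have "d_B M M' < r \<longleftrightarrow> (\<exists>s\<in>?S. s < r)"
    unfolding d_B_def by (rule Min_less_iff)
  also have "\<dots> \<longleftrightarrow> (\<exists>f. bij_betw f M M' \<and> Max ((\<lambda>x. dist x (f x)) ` M) < r)"
    by blast
  also have "\<dots> \<longleftrightarrow> (\<exists>f. bij_betw f M M' \<and> (\<forall>x\<in>M. dist x (f x) < r))"
    using assms(1,2) by (simp add: Max_less_iff)
  finally show ?thesis .
qed

lemma min_gap_distance_set_le:
  assumes "finite M" "r \<in> distance_set M" "r' \<in> distance_set M" "r \<noteq> r'"
  shows "min_gap (distance_set M) \<le> \<bar>r - r'\<bar>"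
proof -
  have "distance_set M \<subseteq> (\<lambda>(x, y). dist x y) ` (M \<times> M)"
    by (auto simp: distance_set_def)
  then have "finite (distance_set M)"
    by (rule finite_subset) (use assms(1) in simp)
  moreover have "{\<bar>r - r'\<bar> | r r'. r \<in> distance_set M \<and> r' \<in> distance_set M \<and> r \<noteq> r'}
      \<subseteq> (\<lambda>(r, r'). \<bar>r - r'\<bar>) ` (distance_set M \<times> distance_set M)"
    by auto
  ultimately have "finite {\<bar>r - r'\<bar> | r r'. r \<in> distance_set M \<and> r' \<in> distance_set M \<and> r \<noteq> r'}"
    using finite_subset by blast
  then show ?thesis
    unfolding min_gap_def using assms by (intro Min_le) auto
qed

lemma abs_dist_diff_less:
  fixes x y x' y' :: "'a::metric_space"
  assumes "dist x x' < \<epsilon>" "dist y y' < \<epsilon>"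
  shows "\<bar>dist x y - dist x' y'\<bar> < 2 * \<epsilon>"
  using assms dist_triangle[of x y x'] dist_triangle[of x' y y']
    dist_triangle[of x' y' x] dist_triangle[of x y' y]
  by (simp add: dist_commute abs_less_iff)

text \<open>Each of two distances changes by less than \<open>2 * \<epsilon>\<close>, so together
  they move towards each other by less than the gap between them.\<close>

lemma distance_separated_perturb:
  assumes fin: "finite M" and sep: "distance_separated M"
    and f: "bij_betw f M M'" and close: "\<And>x. x \<in> M \<Longrightarrow> dist x (f x) < \<epsilon>"
    and gap: "4 * \<epsilon> \<le> min_gap (distance_set M)"
  shows "distance_separated M'"
proof -
  have M': "M' = f ` M"
    using f by (simp add: bij_betw_def)
  have "dist (f x) (f y) \<noteq> dist (f u) (f v)"
    if *: "x \<in> M" "y \<in> M" "u \<in> M" "v \<in> M"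
      "f x \<noteq> f y" "f u \<noteq> f v" "{f x, f y} \<noteq> {f u, f v}" for x y u v
  proof -
    have "x \<noteq> y" "u \<noteq> v" "{x, y} \<noteq> {u, v}"
      using *(5-7) by (auto simp: doubleton_eq_iff)
    then have "dist x y \<noteq> dist u v"
      using sep *(1-4) unfolding distance_separated_def by blast
    then have "min_gap (distance_set M) \<le> \<bar>dist x y - dist u v\<bar>"
      using * by (intro min_gap_distance_set_le fin) (auto simp: distance_set_def)
    then show ?thesis
      using abs_dist_diff_less[OF close[OF *(1)] close[OF *(2)]]
        abs_dist_diff_less[OF close[OF *(3)] close[OF *(4)]] gap by linarith
  qed
  then show ?thesis
    unfolding distance_separated_def M' by blast
qed

section \<open>Approximation by distance separated sets\<close>

text \<open>If \<open>j < l\<close> held as well, the left side would be at most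
  \<open>2 ^ l\<close>, which the right side exceeds.\<close>

lemma power2_sum_eq_imp_le:
  fixes i j k l :: nat
  assumes "(2::real) ^ j + 2 ^ k = 2 ^ l + 2 ^ i" "k < l"
  shows "l \<le> j"
proof (rule ccontr)
  assume "\<not> l \<le> j"
  then have "j \<le> l - 1" "k \<le> l - 1" "l > 0"
    using assms(2) by auto
  then have "(2::real) ^ j \<le> 2 ^ (l - 1)" "(2::real) ^ k \<le> 2 ^ (l - 1)"
    "(2::real) ^ l = 2 * 2 ^ (l - 1)"
    by (auto simp flip: power_Suc)
  moreover have "(2::real) ^ i > 0" by simp
  ultimately show False using assms(1) by linarith
qed

text \<open>With both pairs put in increasing order, the equation becomes one between sums of two
  powers. Comparing in both directions identifies the larger exponents, and cancelling them
  identifies the smaller ones.\<close>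

lemma power2_diff_eq:
  fixes i j k l :: nat
  assumes eq: "\<bar>(2::real) ^ i - 2 ^ j\<bar> = \<bar>2 ^ k - 2 ^ l\<bar>" and "i \<noteq> j" "k \<noteq> l"
  shows "{i, j} = {k, l}"
proof -
  have *: "{i, j} = {k, l}" if "i < j" "k < l" and eq: "\<bar>(2::real) ^ i - 2 ^ j\<bar> = \<bar>2 ^ k - 2 ^ l\<bar>"
    for i j k l :: nat
  proof -
    have "(2::real) ^ i < 2 ^ j" "(2::real) ^ k < 2 ^ l"
      using that by simp_all
    then have sum: "(2::real) ^ j + 2 ^ k = 2 ^ l + 2 ^ i"
      using eq by linarith
    then have "j = l"
      using that power2_sum_eq_imp_le[OF sum] power2_sum_eq_imp_le[OF sum[symmetric]] by simp
    with sum show ?thesis by simp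
  qed
  \<comment> \<open>The four instances cover all orderings within the two pairs.\<close>
  show ?thesis
    using assms(2,3) eq *[of i j k l] *[of j i k l] *[of i j l k] *[of j i l k]
    unfolding neq_iff abs_minus_commute[of "2 ^ j" "2 ^ i"] abs_minus_commute[of "2 ^ l" "2 ^ k"]
      insert_commute[of j i] insert_commute[of l k] by blast
qed

lemma finite_quadratic_roots:
  fixes a b c :: real
  assumes "a \<noteq> 0"
  shows "finite {s. a * s\<^sup>2 + b * s + c = 0}"
proof -
  have "finite {s. poly [:c, b, a:] s = 0}"
    using assms by (intro poly_roots_finite) simp
  then show ?thesis
    by (simp add: algebra_simps power2_eq_square)
qed

lemma distance_separated_dense:
  fixes M :: "'a::euclidean_space set"
  assumes fin: "finite M" and "0 < \<epsilon>"
  obtains f where "inj_on f M" "\<And>x. x \<in> M \<Longrightarrow> dist x (f x) < \<epsilon>" "distance_separated (f ` M)"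
proof -
  obtain idx :: "'a \<Rightarrow> nat" where idx: "inj_on idx M"
    using finite_imp_inj_to_nat_seg[OF fin] by blast
  obtain e :: 'a where "e \<in> Basis"
    using nonempty_Basis by blast
  then have e: "norm e = 1" by simp
  define w :: "'a \<Rightarrow> real" where "w x = 2 ^ idx x" for x
  define f where "f s x = x + (s * w x) *\<^sub>R e" for s x
  define b where "b x y = 2 * (w x - w y) * ((x - y) \<bullet> e)" for x y
  have dist_f: "(dist (f s x) (f s y))\<^sup>2 = (w x - w y)\<^sup>2 * s\<^sup>2 + b x y * s + (dist x y)\<^sup>2" for s x y
  proof -
    have "f s x - f s y = (x - y) + (s * (w x - w y)) *\<^sub>R e"
      by (simp add: f_def algebra_simps)
    moreover have "(norm (z + t *\<^sub>R e))\<^sup>2 = (norm z)\<^sup>2 + 2 * t * (z \<bullet> e) + t\<^sup>2" for z t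
      using dot_norm[of z "t *\<^sub>R e"] e by (simp add: field_simps)
    ultimately show ?thesis
      by (simp add: dist_norm b_def power_mult_distrib)
  qed
  \<comment> \<open>\<open>bad1\<close> collects the parameters at which two points collide,
    \<open>bad2\<close> those at which two pairs acquire the same distance. Working with squared
    distances makes both into root sets of polynomials of degree at most 2.\<close>
  define bad1 where "bad1 = (\<lambda>(x, y). {s. (w x - w y)\<^sup>2 * s\<^sup>2 + b x y * s + (dist x y)\<^sup>2 = 0})"
  define bad2 where "bad2 = (\<lambda>((x, y), (u, v)). {s. ((w x - w y)\<^sup>2 - (w u - w v)\<^sup>2) * s\<^sup>2
      + (b x y - b u v) * s + ((dist x y)\<^sup>2 - (dist u v)\<^sup>2) = 0})"
  define P where "P = {(x, y) \<in> M \<times> M. x \<noteq> y}"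
  define Q where "Q = {((x, y), (u, v)) \<in> P \<times> P. {x, y} \<noteq> {u, v}}"
  have "finite P"
    unfolding P_def using fin by (auto intro: finite_subset[of _ "M \<times> M"])
  moreover have "Q \<subseteq> P \<times> P"
    by (auto simp: Q_def)
  ultimately have "finite Q"
    by (auto intro: finite_subset)
  have idx_eq: "idx x = idx y \<longleftrightarrow> x = y" if "x \<in> M" "y \<in> M" for x y
    using idx that by (simp add: inj_on_eq_iff)
  have "finite (bad1 p)" if "p \<in> P" for p
    using that unfolding P_def bad1_def
    by (auto intro!: finite_quadratic_roots simp: w_def idx_eq)
  moreover have "finite (bad2 q)" if "q \<in> Q" for q
  proof -
    obtain x y u v where q: "q = ((x, y), (u, v))" by (metis surj_pair)
    have xy: "x \<in> M" "y \<in> M" "u \<in> M" "v \<in> M" "x \<noteq> y" "u \<noteq> v" "{x, y} \<noteq> {u, v}"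
      using that by (auto simp: Q_def P_def q)
    then have "idx x \<noteq> idx y" "idx u \<noteq> idx v" "{idx x, idx y} \<noteq> {idx u, idx v}"
      by (auto simp: idx_eq doubleton_eq_iff)
    \<comment> \<open>Here the choice of powers of two as weights pays off: the leading coefficient
      of the difference of the two quadratics is nonzero.\<close>
    then have "\<bar>w x - w y\<bar> \<noteq> \<bar>w u - w v\<bar>"
      unfolding w_def using power2_diff_eq by blast
    then have "(w x - w y)\<^sup>2 - (w u - w v)\<^sup>2 \<noteq> 0"
      by (simp add: power2_eq_iff abs_eq_iff)
    then show ?thesis
      unfolding q bad2_def prod.case by (rule finite_quadratic_roots)
  qed
  ultimately have fin_bad: "finite (\<Union> (bad1 ` P) \<union> \<Union> (bad2 ` Q))"
    using \<open>finite P\<close> \<open>finite Q\<close> by blast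
  \<comment> \<open>\<open>W\<close> strictly exceeds every weight, so any
    \<open>s < \<epsilon> / W\<close> displaces each point by less than \<epsilon>. The summand 1
    keeps \<open>W\<close> positive even for empty \<open>M\<close>.\<close>
  define W where "W = (\<Sum>x\<in>M. w x) + 1"
  have w_pos: "w x > 0" for x by (simp add: w_def)
  have w_less: "w x < W" if "x \<in> M" for x
    using member_le_sum[OF that, of w] w_pos fin unfolding W_def by (simp add: less_imp_le)
  have "W > 0"
    unfolding W_def using w_pos by (simp add: add_nonneg_pos sum_nonneg less_imp_le)
  then have "infinite {0<..<\<epsilon> / W}"
    using \<open>0 < \<epsilon>\<close> by simp
  from Diff_infinite_finite[OF fin_bad this]
  obtain s where "s \<in> {0<..<\<epsilon> / W} - (\<Union> (bad1 ` P) \<union> \<Union> (bad2 ` Q))"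
    by (metis equals0I infinite_imp_nonempty)
  then have s: "0 < s" "s < \<epsilon> / W" and
    good1: "\<And>p. p \<in> P \<Longrightarrow> s \<notin> bad1 p" and good2: "\<And>q. q \<in> Q \<Longrightarrow> s \<notin> bad2 q"
    by simp_all
  show ?thesis
  proof (rule that)
    show "inj_on (f s) M"
    proof (rule inj_onI, rule ccontr)
      fix x y
      assume *: "x \<in> M" "y \<in> M" "f s x = f s y" "x \<noteq> y"
      then have "s \<notin> bad1 (x, y)" by (intro good1) (simp add: P_def)
      then show False using *(3) dist_f[of s x y] by (simp add: bad1_def)
    qed
    show "dist x (f s x) < \<epsilon>" if "x \<in> M" for x
    proof -
      have "dist x (f s x) = s * w x"
        using e s(1) w_pos[of x] by (simp add: f_def dist_norm)
      also have "\<dots> < s * W"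
        using s(1) w_less[OF that] by simp
      also have "\<dots> < \<epsilon>"
        using s(2) \<open>W > 0\<close> by (simp add: field_simps)
      finally show ?thesis .
    qed
    have "dist (f s x) (f s y) \<noteq> dist (f s u) (f s v)"
      if "x \<in> M" "y \<in> M" "u \<in> M" "v \<in> M"
        "f s x \<noteq> f s y" "f s u \<noteq> f s v" "{f s x, f s y} \<noteq> {f s u, f s v}" for x y u v
    proof
      assume "dist (f s x) (f s y) = dist (f s u) (f s v)"
      then have "(dist (f s x) (f s y))\<^sup>2 = (dist (f s u) (f s v))\<^sup>2" by simp
      then have "s \<in> bad2 ((x, y), (u, v))"
        unfolding dist_f by (simp add: bad2_def algebra_simps)
      \<comment> \<open>Distinct images, and distinct pairs of images, come from distinct points and
        distinct pairs.\<close>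
      moreover have "((x, y), (u, v)) \<in> Q"
        using that by (auto simp: P_def Q_def doubleton_eq_iff)
      ultimately show False using good2 by blast
    qed
    then show "distance_separated (f s ` M)"
      unfolding distance_separated_def by blast
  qed
qed

theorem theorem4p3:
  fixes m :: nat and M :: "(real ^ 'n) set" and \<epsilon> :: real
  assumes "m \<ge> 2"
    and "M \<in> Msets m"
    and "0 < \<epsilon>"
    and "\<epsilon> < min_gap (distance_set M) / 10"
  shows "(\<exists>M' \<in> ds m. d_B M M' < \<epsilon> \<and> graph_tree (CS M')) \<and>
         (M \<in> ds m \<longrightarrow> (\<forall>M' \<in> M_ball m M \<epsilon>. graph_tree (CS M')))"
proof -
  have fin: "finite M" and card: "card M = m"
    using assms(2) by (auto simp: Msets_def)
  have nonempty: "K \<noteq> {}" if "card K = m" for K :: "(real ^ 'n) set"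
    using that assms(1) by auto
  obtain f where f: "inj_on f M" "\<And>x. x \<in> M \<Longrightarrow> dist x (f x) < \<epsilon>"
    "distance_separated (f ` M)"
    using distance_separated_dense[OF fin assms(3)] by blast
  have card': "card (f ` M) = m"
    using f(1) card by (simp add: card_image)
  have "d_B M (f ` M) < \<epsilon>"
    using d_B_less_iff[OF fin nonempty[OF card], of "f ` M"] card card' fin f
    by (auto intro!: exI[of _ f] simp: bij_betw_def)
  moreover have "f ` M \<in> ds m"
    using fin card' f(3) by (simp add: ds_def Msets_def)
  moreover have "graph_tree (CS (f ` M))"
    using fin nonempty[OF card'] f(3) by (intro CS_tree) auto
  moreover have "graph_tree (CS M')" if "M \<in> ds m" "M' \<in> M_ball m M \<epsilon>" for M'
  proof -
    have M': "finite M'" "card M' = m" "d_B M M' < \<epsilon>"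
      using that(2) by (auto simp: M_ball_def Msets_def)
    then obtain g where g: "bij_betw g M M'" "\<And>x. x \<in> M \<Longrightarrow> dist x (g x) < \<epsilon>"
      using d_B_less_iff[OF fin nonempty[OF card], of M'] card by auto
    have "distance_separated M"
      using that(1) by (simp add: ds_def)
    \<comment> \<open>As \<epsilon> is positive, the bound
      \<open>\<epsilon> < min_gap (distance_set M) / 10\<close> yields the required
      \<open>4 * \<epsilon> \<le> min_gap (distance_set M)\<close>.\<close>
    then have "distance_separated M'"
      using distance_separated_perturb[OF fin _ g] assms(3,4) by simp
    then show ?thesis
      using M'(1) nonempty[OF M'(2)] by (intro CS_tree)
  qed
  ultimately show ?thesis by blast
qed

end
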